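(* Let $t\geq 3$ and $\tau\geq 1$ be integers, and let $\boldsymbol{F}\in\{1,-1\}^{\tau\times t}\subset\mathbb{R}^{\tau\times t}$ be a matrix with rows $T^1,T^2,\ldots,T^{\tau}\in\{1,-1\}^t$. For each $i$ with $1\leq i\leq \tau$, let $\boldsymbol{Q}(T^i,\boldsymbol{R})=\{R^{k_0(T^i)},R^{k_1(T^i)},\ldots,R^{k_{\mathfrak{q}(T^i)-1}(T^i)}\}$, with $k_0(T^i)<k_1(T^i)<\cdots<k_{\mathfrak{q}(T^i)-1}(T^i)$ and $\mathfrak{q}(T^i)=|\boldsymbol{Q}(T^i,\boldsymbol{R})|$, be the decomposition set of $T^i$ with respect to the distinguished symmetric cycle $\boldsymbol{R}$ of the hypercube graph $\boldsymbol{H}(t,2)$. Consider the tuple $$\Big(t,\ \tau,\ \{k_0(T^1),\ldots,k_{\mathfrak{q}(T^1)-1}(T^1)\},\ \{k_0(T^2),\ldots,k_{\mathfrak{q}(T^2)-1}(T^2)\},\ \ldots,\ \{k_0(T^{\tau}),\ldots,k_{\mathfrak{q}(T^{\tau})-1}(T^{\tau})\}\Big),$$ consisting of the parameters $t$ and $\tau$ and of the sequence of $\tau$ sets of indices. This tuple allows one to restore the matrix $\boldsymbol{F}$ exactly (that is, it determines $\boldsymbol{F}$ uniquely), and for it we have $$\tau\ \leq\ \sum_{i=1}^{\tau}\mathfrak{q}(T^i)\ \leq\ \begin{cases}\tau\cdot t, & \text{if } t \text{ is odd},\\ \tau\cdot(t-1), & \text{if } t \text{ is even}.\end{cases}$$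
   Context: The hypercube graph $\boldsymbol{H}(t,2)$ has vertex set $\{1,-1\}^t\subset\mathbb{R}^t$; two vertices are adjacent if and only if they differ in exactly one coordinate. The distinguished symmetric cycle $\boldsymbol{R}=(R^0,R^1,\ldots,R^{2t-1},R^0)$ of $\boldsymbol{H}(t,2)$ has vertex sequence $\vec{\mathrm{V}}(\boldsymbol{R})=(R^0,R^1,\ldots,R^{2t-1})$ defined by: $R^0:=(1,1,\ldots,1)$; for $1\leq s\leq t-1$, $R^s$ is the vector whose first $s$ coordinates are $-1$ and whose last $t-s$ coordinates are $1$; and $R^{k+t}:=-R^k$ for $0\leq k\leq t-1$. For any vertex $T\in\{1,-1\}^t$ there is a unique inclusion-minimal subset $\boldsymbol{Q}(T,\boldsymbol{R})$ of $\{R^0,R^1,\ldots,R^{2t-1}\}$ such that $T=\sum_{Q\in\boldsymbol{Q}(T,\boldsymbol{R})}Q$ (sum in $\mathbb{R}^t$). This set is called the decomposition set of $T$ with respect to $\boldsymbol{R}$, and its cardinality is denoted $\mathfrak{q}(T):=|\boldsymbol{Q}(T,\boldsymbol{R})|$. The integers $k_j(T)\in\{0,1,\ldots,2t-1\}$ are the superscripts of the elements of $\boldsymbol{Q}(T,\boldsymbol{R})$, listed in increasing order. *)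

theory Defs
  imports "Jordan_Normal_Form.Matrix"
begin

text \<open>Coordinates, matrix rows and matrix columns are numbered from 0: the entry
  \<open>v $ i\<close> is the (i+1)-st coordinate of \<open>v\<close>, and \<open>row F i\<close> is the (i+1)-st row of \<open>F\<close>.\<close>

definition hypercube_vertices :: "nat \<Rightarrow> real vec set" where
  "hypercube_vertices t = {v \<in> carrier_vec t. \<forall>i<t. v $ i \<in> {1, -1}}"

definition sign_matrices :: "nat \<Rightarrow> nat \<Rightarrow> real mat set" where
  "sign_matrices \<tau> t = {F \<in> carrier_mat \<tau> t. \<forall>i<\<tau>. row F i \<in> hypercube_vertices t}"

text \<open>Intended for \<open>k < 2 * t\<close> only; the values at larger \<open>k\<close> are never used.\<close>

definition cycle_vertex :: "nat \<Rightarrow> nat \<Rightarrow> real vec" where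
  "cycle_vertex t k =
    (if k < t then vec t (\<lambda>i. if i < k then -1 else 1)
     else - vec t (\<lambda>i. if i < k - t then -1 else 1))"

definition cycle_vertices :: "nat \<Rightarrow> real vec set" where
  "cycle_vertices t = cycle_vertex t ` {..<2 * t}"

definition sums_to :: "nat \<Rightarrow> real vec \<Rightarrow> real vec set \<Rightarrow> bool" where
  "sums_to t T Q \<longleftrightarrow> Q \<subseteq> cycle_vertices t \<and> T = finsum_vec TYPE(real) t (\<lambda>v. v) Q"

definition minimal_decomposition :: "nat \<Rightarrow> real vec \<Rightarrow> real vec set \<Rightarrow> bool" where
  "minimal_decomposition t T Q \<longleftrightarrow> sums_to t T Q \<and> (\<forall>Q'. Q' \<subset> Q \<longrightarrow> \<not> sums_to t T Q')"

text \<open>For a vertex \<open>T\<close> of the hypercube exactly one minimal decomposition exists: a minimal one never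
  contains both \<open>v\<close> and \<open>- v\<close>, so it is read off from the coefficients, all in \<open>{-1, 0, 1}\<close>,
  of \<open>T\<close> in the basis \<open>cycle_vertex t 0, ..., cycle_vertex t (t - 1)\<close>.\<close>

definition decomposition_set :: "nat \<Rightarrow> real vec \<Rightarrow> real vec set" where
  "decomposition_set t T = (THE Q. minimal_decomposition t T Q)"

definition decomposition_size :: "nat \<Rightarrow> real vec \<Rightarrow> nat" where
  "decomposition_size t T = card (decomposition_set t T)"

definition decomposition_index :: "nat \<Rightarrow> real vec \<Rightarrow> nat \<Rightarrow> nat" where
  "decomposition_index t T j =
    sorted_list_of_set {k. k < 2 * t \<and> cycle_vertex t k \<in> decomposition_set t T} ! j"

definition decomposition_tuple :: "nat \<Rightarrow> nat \<Rightarrow> real mat \<Rightarrow> nat \<times> nat \<times> nat set list" where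
  "decomposition_tuple t \<tau> F =
    (t, \<tau>, map (\<lambda>i. decomposition_index t (row F i) ` {..<decomposition_size t (row F i)}) [0..<\<tau>])"

end

theory Submission
  imports Defs
begin

text \<open>
  Listing the sign vector \<open>T\<close> followed by \<open>- T\<close> around a circle of length \<open>2 * t\<close>, one reads off the
  decomposition set: it consists of the \<open>cycle_vertex t k\<close> for those positions \<open>k\<close> at which the
  circular word ascends from \<open>-1\<close> to \<open>1\<close>. The algebra behind this is the linear functional
  \<open>half_step t k\<close>, half the difference of the entries at \<open>k\<close> and at its circular predecessor. These
  functionals, for \<open>k < t\<close>, form the basis dual to \<open>cycle_vertex t 0, ..., cycle_vertex t (t - 1)\<close>,
  and they take values in \<open>{-1, 0, 1}\<close> on sign vectors. Applied to a set \<open>Q\<close> of cycle vertices with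
  sum \<open>T\<close>, they say how \<open>cycle_vertex t k\<close> and its negative occur in \<open>Q\<close>: a value \<open>1\<close> forces the
  former into \<open>Q\<close>, a value \<open>-1\<close> the latter. The vectors forced in this way already sum to \<open>T\<close>
  because a vector is determined by the values of the functionals; hence they form
  the least set summing to \<open>T\<close>, which is the unique minimal one
  (lemma \<open>decomposition_set_eq\<close>).

  The three claims follow. The rows are the sums of their decomposition sets, and a cycle vertex and
  its index determine each other, so the tuple determines the matrix. At most one vector is forced
  for each \<open>k < t\<close>, so a decomposition set has at most \<open>t\<close> elements. Finally, its size is odd: in
  any one coordinate, the entries \<open>1\<close> and \<open>-1\<close> of its elements sum to \<open>1\<close> or \<open>-1\<close>. Oddness gives the
  lower bound \<open>1\<close> and improves the upper bound to \<open>t - 1\<close> for even \<open>t\<close>.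
\<close>

section \<open>Coordinates with respect to the symmetric cycle\<close>

text \<open>The circular predecessor of position \<open>0\<close> is the last position of \<open>- v\<close>, whence the sign.\<close>

definition half_step :: "nat \<Rightarrow> nat \<Rightarrow> real vec \<Rightarrow> real" where
  "half_step t k v = (v $ k - (if k = 0 then - v $ (t - 1) else v $ (k - 1))) / 2"

lemma cycle_vertex_carrier: "cycle_vertex t k \<in> carrier_vec t"
  by (auto simp: cycle_vertex_def)

lemma cycle_vertex_entry: "i < t \<Longrightarrow> cycle_vertex t k $ i \<in> {1, -1}"
  by (auto simp: cycle_vertex_def)

lemma cycle_vertices_carrier: "cycle_vertices t \<subseteq> carrier_vec t"
  by (auto simp: cycle_vertices_def cycle_vertex_carrier)

lemma finite_cycle_vertices: "finite (cycle_vertices t)"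
  by (simp add: cycle_vertices_def)

lemma half_step_cycle_vertex:
  assumes "k < t" and "j < 2 * t"
  shows "half_step t k (cycle_vertex t j) = (if j = k then 1 else if j = k + t then -1 else 0)"
  using assms by (auto simp: half_step_def cycle_vertex_def)

lemma cycle_vertex_inj: "inj_on (cycle_vertex t) {..<2 * t}"
proof (rule inj_onI)
  fix i j
  assume i: "i \<in> {..<2 * t}" and j: "j \<in> {..<2 * t}"
    and eq: "cycle_vertex t i = cycle_vertex t j"
  \<comment> \<open>The functional that does not vanish at the vertex number \<open>i\<close> tells it apart from all others.\<close>
  define k where "k = (if i < t then i else i - t)"
  have k: "k < t" "i = k \<or> i = k + t" using i by (auto simp: k_def)
  have "half_step t k (cycle_vertex t i) = half_step t k (cycle_vertex t j)"
    by (simp add: eq)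
  then show "i = j"
    using k i j by (auto simp: half_step_cycle_vertex split: if_splits)
qed

text \<open>If all functionals agree on \<open>v\<close> and \<open>w\<close>, then \<open>v - w\<close> is constant along the coordinates, and the
  change of sign in passing from the last position to the first forces the constant to be \<open>0\<close>.\<close>

lemma half_steps_determine_vec:
  assumes v: "v \<in> carrier_vec t" and w: "w \<in> carrier_vec t"
    and eq: "\<And>k. k < t \<Longrightarrow> half_step t k v = half_step t k w"
  shows "v = w"
proof (rule eq_vecI)
  show "dim_vec v = dim_vec w" using v w by simp
next
  fix i assume "i < dim_vec w"
  then have i: "i < t" using w by simp
  have const: "v $ n - w $ n = v $ 0 - w $ 0" if "n < t" for n
    using that
  proof (induction n)
    case (Suc n)
    then show ?case using eq[of "Suc n"] by (simp add: half_step_def)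
  qed simp
  have "v $ 0 - w $ 0 = - (v $ (t - 1) - w $ (t - 1))"
    using eq[of 0] i by (simp add: half_step_def)
  then have "v $ 0 - w $ 0 = 0"
    using const[of "t - 1"] i by simp
  then show "v $ i = w $ i" using const[OF i] by simp
qed

section \<open>Sums of cycle vertices\<close>

lemma finsum_cycle_vertices_index:
  assumes "Q \<subseteq> cycle_vertices t" and "i < t"
  shows "finsum_vec TYPE(real) t (\<lambda>v. v) Q $ i = (\<Sum>v\<in>Q. v $ i)"
  using assms finite_cycle_vertices cycle_vertices_carrier
  by (intro index_finsum_vec) (auto intro: finite_subset)

lemma half_step_finsum_cycle_vertices:
  assumes Q: "Q \<subseteq> cycle_vertices t" and k: "k < t"
  shows "half_step t k (finsum_vec TYPE(real) t (\<lambda>v. v) Q) =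
    of_bool (cycle_vertex t k \<in> Q) - of_bool (cycle_vertex t (k + t) \<in> Q)"
proof -
  let ?p = "cycle_vertex t k" and ?m = "cycle_vertex t (k + t)"
  have fin: "finite Q" using Q finite_cycle_vertices by (rule finite_subset)
  have "half_step t k (finsum_vec TYPE(real) t (\<lambda>v. v) Q) = (\<Sum>v\<in>Q. half_step t k v)"
    using Q k
    by (simp add: half_step_def finsum_cycle_vertices_index sum_divide_distrib[symmetric]
        sum_subtractf sum_negf sum.distrib)
  \<comment> \<open>Only two cycle vertices contribute.\<close>
  also have "\<dots> = (\<Sum>v\<in>Q. of_bool (v = ?p) - of_bool (v = ?m))"
  proof (rule sum.cong)
    fix v assume "v \<in> Q"
    then obtain j where j: "j < 2 * t" "v = cycle_vertex t j"
      using Q by (auto simp: cycle_vertices_def)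
    have "cycle_vertex t j = cycle_vertex t l \<longleftrightarrow> j = l" if "l < 2 * t" for l
      using inj_on_eq_iff[OF cycle_vertex_inj] j(1) that by simp
    then show "half_step t k v = of_bool (v = ?p) - of_bool (v = ?m)"
      using j k by (simp add: half_step_cycle_vertex)
  qed simp
  also have "\<dots> = of_bool (?p \<in> Q) - of_bool (?m \<in> Q)"
    using fin by (simp add: sum_subtractf of_bool_def)
  finally show ?thesis .
qed

section \<open>The decomposition set\<close>

text \<open>The index \<open>k + t\<close> is that of the negative of \<open>cycle_vertex t k\<close>. Parametrising the set by the
  \<open>k < t\<close> with nonzero coefficient makes the bound \<open>t\<close> on its size visible.\<close>

definition forced_vertices :: "nat \<Rightarrow> real vec \<Rightarrow> real vec set" where
  "forced_vertices t T =
    (\<lambda>k. cycle_vertex t (if half_step t k T = 1 then k else k + t)) ` {k. k < t \<and> half_step t k T \<noteq> 0}"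

lemma half_step_hypercube_vertex:
  assumes "T \<in> hypercube_vertices t" and "k < t"
  shows "half_step t k T \<in> {-1, 0, 1}"
proof -
  have "T $ i = 1 \<or> T $ i = -1" if "i < t" for i
    using assms(1) that by (auto simp: hypercube_vertices_def)
  from this[of k] this[of "k - 1"] this[of "t - 1"] assms(2) show ?thesis
    by (auto simp: half_step_def)
qed

lemma forced_vertices_subset_cycle: "forced_vertices t T \<subseteq> cycle_vertices t"
  by (auto simp: forced_vertices_def cycle_vertices_def)

lemma cycle_vertex_in_forced_vertices_iff:
  assumes T: "T \<in> hypercube_vertices t" and k: "k < t"
  shows "cycle_vertex t k \<in> forced_vertices t T \<longleftrightarrow> half_step t k T = 1"
    and "cycle_vertex t (k + t) \<in> forced_vertices t T \<longleftrightarrow> half_step t k T = -1"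
proof -
  have mem: "cycle_vertex t j \<in> forced_vertices t T \<longleftrightarrow>
      (\<exists>l<t. half_step t l T \<noteq> 0 \<and> j = (if half_step t l T = 1 then l else l + t))"
    if "j < 2 * t" for j
  proof -
    have "cycle_vertex t j = cycle_vertex t l \<longleftrightarrow> j = l" if "l < 2 * t" for l
      using inj_on_eq_iff[OF cycle_vertex_inj] \<open>j < 2 * t\<close> that by simp
    then show ?thesis unfolding forced_vertices_def image_iff by auto
  qed
  show "cycle_vertex t k \<in> forced_vertices t T \<longleftrightarrow> half_step t k T = 1"
    using k by (auto simp: mem split: if_splits)
  show "cycle_vertex t (k + t) \<in> forced_vertices t T \<longleftrightarrow> half_step t k T = -1"
    using k half_step_hypercube_vertex[OF T k] by (auto simp: mem split: if_splits)
qed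

lemma sums_to_forced_vertices:
  assumes T: "T \<in> hypercube_vertices t"
  shows "sums_to t T (forced_vertices t T)"
  unfolding sums_to_def
proof
  show "T = finsum_vec TYPE(real) t (\<lambda>v. v) (forced_vertices t T)"
  proof (rule half_steps_determine_vec)
    show "T \<in> carrier_vec t" using T by (simp add: hypercube_vertices_def)
    show "finsum_vec TYPE(real) t (\<lambda>v. v) (forced_vertices t T) \<in> carrier_vec t"
      using forced_vertices_subset_cycle cycle_vertices_carrier by (intro finsum_vec_closed) blast
  next
    fix k assume k: "k < t"
    show "half_step t k T = half_step t k (finsum_vec TYPE(real) t (\<lambda>v. v) (forced_vertices t T))"
      using half_step_hypercube_vertex[OF T k]
      by (auto simp: half_step_finsum_cycle_vertices[OF forced_vertices_subset_cycle k]
          cycle_vertex_in_forced_vertices_iff[OF T k])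
  qed
qed (rule forced_vertices_subset_cycle)

text \<open>A functional with value \<open>1\<close> (or \<open>-1\<close>) at the sum is a difference of two truth values, the first
  (or second) of which must then be true.\<close>

lemma forced_vertices_least:
  assumes T: "T \<in> hypercube_vertices t" and Q: "sums_to t T Q"
  shows "forced_vertices t T \<subseteq> Q"
proof
  fix v assume "v \<in> forced_vertices t T"
  then obtain k where k: "k < t" "half_step t k T \<noteq> 0"
    and v: "v = cycle_vertex t (if half_step t k T = 1 then k else k + t)"
    by (auto simp: forced_vertices_def)
  have "half_step t k T = of_bool (cycle_vertex t k \<in> Q) - of_bool (cycle_vertex t (k + t) \<in> Q)"
    using Q half_step_finsum_cycle_vertices[OF _ k(1)] by (auto simp: sums_to_def)
  then show "v \<in> Q" using k(2) v by (auto simp: of_bool_def split: if_splits)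
qed

lemma decomposition_set_eq:
  assumes T: "T \<in> hypercube_vertices t"
  shows "decomposition_set t T = forced_vertices t T"
  unfolding decomposition_set_def
proof (rule the_equality)
  have "\<not> sums_to t T Q" if "Q \<subset> forced_vertices t T" for Q
    using forced_vertices_least[OF T, of Q] that by blast
  then show "minimal_decomposition t T (forced_vertices t T)"
    using sums_to_forced_vertices[OF T] unfolding minimal_decomposition_def by blast
next
  fix Q assume Q: "minimal_decomposition t T Q"
  then have "forced_vertices t T \<subseteq> Q"
    unfolding minimal_decomposition_def using forced_vertices_least[OF T] by blast
  moreover have "\<not> forced_vertices t T \<subset> Q"
    using Q sums_to_forced_vertices[OF T] unfolding minimal_decomposition_def by blast
  ultimately show "Q = forced_vertices t T" by blast
qed

lemma sums_to_decomposition_set: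
  "T \<in> hypercube_vertices t \<Longrightarrow> sums_to t T (decomposition_set t T)"
  by (simp add: decomposition_set_eq sums_to_forced_vertices)

section \<open>Recovering a vertex from its indices\<close>

lemma decomposition_index_image:
  assumes T: "T \<in> hypercube_vertices t"
  shows "decomposition_index t T ` {..<decomposition_size t T} =
    {k. k < 2 * t \<and> cycle_vertex t k \<in> decomposition_set t T}" (is "_ = ?K")
proof -
  have image: "cycle_vertex t ` ?K = decomposition_set t T"
    using sums_to_decomposition_set[OF T] by (auto simp: sums_to_def cycle_vertices_def)
  have "inj_on (cycle_vertex t) ?K"
    using cycle_vertex_inj by (rule inj_on_subset) auto
  then have size: "decomposition_size t T = card ?K"
    using card_image[of "cycle_vertex t" ?K] by (simp only: image decomposition_size_def)
  have "(!) xs ` {..<length xs} = set xs" for xs :: "nat list"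
    by (auto simp: set_conv_nth)
  from this[of "sorted_list_of_set ?K"]
  have "decomposition_index t T ` {..<card ?K} = ?K"
    by (simp add: decomposition_index_def)
  then show ?thesis by (simp only: size)
qed

lemma hypercube_vertex_determined_by_indices:
  assumes S: "S \<in> hypercube_vertices t" and T: "T \<in> hypercube_vertices t"
    and eq: "decomposition_index t S ` {..<decomposition_size t S} =
      decomposition_index t T ` {..<decomposition_size t T}"
  shows "S = T"
proof -
  have "decomposition_set t S = decomposition_set t T"
    using eq sums_to_decomposition_set[OF S] sums_to_decomposition_set[OF T]
    unfolding decomposition_index_image[OF S] decomposition_index_image[OF T]
    by (auto simp: sums_to_def cycle_vertices_def)
  then show ?thesis
    using sums_to_decomposition_set[OF S] sums_to_decomposition_set[OF T]
    by (simp add: sums_to_def)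
qed

section \<open>The size of a decomposition set\<close>

lemma sum_of_signs_parity:
  fixes f :: "'a \<Rightarrow> real"
  assumes "finite A" and "\<And>x. x \<in> A \<Longrightarrow> f x \<in> {1, -1}"
  shows "\<exists>m. sum f A = of_int m \<and> (even m \<longleftrightarrow> even (card A))"
  using assms
proof (induction A rule: finite_induct)
  case empty
  show ?case by (rule exI[of _ 0]) simp
next
  case (insert x A)
  then obtain m where m: "sum f A = of_int m" "even m \<longleftrightarrow> even (card A)" by auto
  from insert.prems[of x] consider "f x = 1" | "f x = -1" by auto
  then show ?case
  proof cases
    case 1
    then show ?thesis using m insert.hyps by (intro exI[of _ "m + 1"]) simp
  next
    case 2
    then show ?thesis using m insert.hyps by (intro exI[of _ "m - 1"]) simp
  qed
qed

lemma odd_decomposition_size: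
  assumes t: "t > 0" and T: "T \<in> hypercube_vertices t"
  shows "odd (decomposition_size t T)"
proof -
  let ?Q = "decomposition_set t T"
  have Q: "?Q \<subseteq> cycle_vertices t" and sum: "T = finsum_vec TYPE(real) t (\<lambda>v. v) ?Q"
    using sums_to_decomposition_set[OF T] by (auto simp: sums_to_def)
  have "finite ?Q" using Q finite_cycle_vertices by (rule finite_subset)
  moreover have "v $ 0 \<in> {1, -1}" if "v \<in> ?Q" for v
    using that Q cycle_vertex_entry[OF t] by (auto simp: cycle_vertices_def)
  ultimately obtain m where m: "(\<Sum>v\<in>?Q. v $ 0) = of_int m" "even m \<longleftrightarrow> even (card ?Q)"
    using sum_of_signs_parity[of ?Q "\<lambda>v. v $ 0"] by auto
  have "T $ 0 = of_int m"
    using sum finsum_cycle_vertices_index[OF Q t] m(1) by simp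
  moreover have "T $ 0 \<in> {1, -1}" using T t by (simp add: hypercube_vertices_def)
  ultimately have "m = 1 \<or> m = -1" by auto
  then show ?thesis using m(2) by (auto simp: decomposition_size_def)
qed

lemma decomposition_size_le:
  assumes T: "T \<in> hypercube_vertices t"
  shows "decomposition_size t T \<le> t"
proof -
  have "card (forced_vertices t T) \<le> card {k. k < t \<and> half_step t k T \<noteq> 0}"
    unfolding forced_vertices_def by (rule card_image_le) simp
  also have "\<dots> \<le> card {..<t}" by (rule card_mono) auto
  finally show ?thesis by (simp add: decomposition_size_def decomposition_set_eq[OF T])
qed

lemma decomposition_size_le_odd:
  assumes t: "t > 0" and T: "T \<in> hypercube_vertices t"
  shows "decomposition_size t T \<le> (if odd t then t else t - 1)"
proof (cases "odd t")
  case False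
  then have "decomposition_size t T \<noteq> t" using odd_decomposition_size[OF t T] by auto
  then show ?thesis using decomposition_size_le[OF T] False by simp
qed (simp add: decomposition_size_le[OF T])

section \<open>Matrices\<close>

lemma decomposition_tuple_inj:
  assumes F: "F \<in> sign_matrices \<tau> t" and F': "F' \<in> sign_matrices \<tau>' t'"
    and eq: "decomposition_tuple t' \<tau>' F' = decomposition_tuple t \<tau> F"
  shows "F' = F"
proof -
  have dims: "t' = t" "\<tau>' = \<tau>" using eq by (auto simp: decomposition_tuple_def)
  have rows: "row F' i = row F i" if "i < \<tau>" for i
  proof (rule hypercube_vertex_determined_by_indices)
    show "row F' i \<in> hypercube_vertices t" "row F i \<in> hypercube_vertices t"
      using F F' dims that by (auto simp: sign_matrices_def)
    show "decomposition_index t (row F' i) ` {..<decomposition_size t (row F' i)} =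
      decomposition_index t (row F i) ` {..<decomposition_size t (row F i)}"
      using eq that unfolding decomposition_tuple_def dims by auto
  qed
  show ?thesis
    using F F' dims rows by (intro eq_rowI) (auto simp: sign_matrices_def)
qed

theorem theorem2p1:
  fixes t \<tau> :: nat and F :: "real mat"
  assumes "t \<ge> 3" and "\<tau> \<ge> 1" and "F \<in> sign_matrices \<tau> t"
  shows "(\<forall>t' \<tau>' F'. t' \<ge> 3 \<longrightarrow> \<tau>' \<ge> 1 \<longrightarrow> F' \<in> sign_matrices \<tau>' t' \<longrightarrow>
            decomposition_tuple t' \<tau>' F' = decomposition_tuple t \<tau> F \<longrightarrow> F' = F)
       \<and> \<tau> \<le> (\<Sum>i<\<tau>. decomposition_size t (row F i))
       \<and> (\<Sum>i<\<tau>. decomposition_size t (row F i)) \<le> (if odd t then \<tau> * t else \<tau> * (t - 1))"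
proof (intro conjI)
  have t: "t > 0" using assms(1) by simp
  have T: "row F i \<in> hypercube_vertices t" if "i < \<tau>" for i
    using assms(3) that by (simp add: sign_matrices_def)
  show "\<forall>t' \<tau>' F'. t' \<ge> 3 \<longrightarrow> \<tau>' \<ge> 1 \<longrightarrow> F' \<in> sign_matrices \<tau>' t' \<longrightarrow>
      decomposition_tuple t' \<tau>' F' = decomposition_tuple t \<tau> F \<longrightarrow> F' = F"
    using decomposition_tuple_inj[OF assms(3)] by blast
  have "(\<Sum>i<\<tau>. 1) \<le> (\<Sum>i<\<tau>. decomposition_size t (row F i))"
  proof (rule sum_mono)
    fix i assume "i \<in> {..<\<tau>}"
    then have "odd (decomposition_size t (row F i))" using odd_decomposition_size[OF t T] by simp
    then show "1 \<le> decomposition_size t (row F i)" using odd_pos by fastforce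
  qed
  then show "\<tau> \<le> (\<Sum>i<\<tau>. decomposition_size t (row F i))" by simp
  have "(\<Sum>i<\<tau>. decomposition_size t (row F i)) \<le> (\<Sum>i<\<tau>. if odd t then t else t - 1)"
    using decomposition_size_le_odd[OF t T] by (intro sum_mono) simp
  then show "(\<Sum>i<\<tau>. decomposition_size t (row F i)) \<le> (if odd t then \<tau> * t else \<tau> * (t - 1))"
    by (simp split: if_splits)
qed

end
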